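(* Let $n,m\ge 1$ be integers and let $f_1,\dots,f_m:\mathbb{R}^n\to\mathbb{R}$ be convex and twice continuously differentiable, such that for each $i$ the Hessian $\nabla^2 f_i$ is Lipschitz continuous (in operator norm) with constant $H_i>0$; put $H:=\max_{1\le i\le m}H_i$. Let $x^0\in\mathbb{R}^n$ and suppose that the level set $\mathcal{L}_0:=\{x\in\mathbb{R}^n: f_i(x)\le f_i(x^0)\text{ for all } i=1,\dots,m\}$ is compact. Let $\{x^k\}$ be generated from $x^0$ by the multi-objective regularized Newton method described in the context. If the method does not terminate in finitely many iterations, then $$\mathcal{U}(x^k)=o(1/k^2)\qquad (k\to\infty),$$ i.e. $k^2\,\mathcal{U}(x^k)\to 0$. If the method terminates, the terminal point is weakly Pareto optimal.
   Context: Write $[m]=\{1,\dots,m\}$ and $\Delta_m=\{\lambda\in\mathbb{R}^m:\lambda_i\ge 0,\ \sum_i\lambda_i=1\}$; $\|\cdot\|$ is the Euclidean norm. Merit function: $\mathcal{U}(x):=\sup_{z\in\mathbb{R}^n}\min_{i\in[m]}\{f_i(x)-f_i(z)\}$. Weak Pareto optimality: $x$ is weakly Pareto optimal if there is no $y\in\mathbb{R}^n$ with $f_i(y)<f_i(x)$ for all $i\in[m]$. Stationarity measure: $s(x):=\min_{\lambda\in\Delta_m}\bigl\|\sum_{i=1}^m\lambda_i\nabla f_i(x)\bigr\|$. Quadratic models: $q_i(d;x):=\langle\nabla f_i(x),d\rangle+\tfrac12 d^\top\nabla^2 f_i(x)d$. Multi-objective regularized Newton method: starting from $x^0$, for $k=0,1,2,\dots$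 compute $s_k:=s(x^k)$. If $s_k=0$, stop and return $x^k$ (the terminal point). Otherwise set $\eta_k:=2\sqrt{H s_k}$, let $d^k$ be the unique minimizer over $d\in\mathbb{R}^n$ of $\max_{i\in[m]}q_i(d;x^k)+\frac{\eta_k}{2}\|d\|^2$, and set $x^{k+1}:=x^k+d^k$. *)

theory Defs
  imports "HOL-Analysis.Analysis"
begin

text \<open>
  The objectives form a family \<open>f :: 'm \<Rightarrow> real^'n \<Rightarrow> real\<close> over finite types \<open>'m\<close> and \<open>'n\<close>;
  types are nonempty, so \<open>m, n \<ge> 1\<close>, and every \<open>Max\<close>/\<open>Min\<close> over \<open>'m\<close> is that of a finite
  nonempty set.
\<close>

definition grad :: "(real^'n \<Rightarrow> real) \<Rightarrow> real^'n \<Rightarrow> real^'n" where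
  "grad g x = (THE D. GDERIV g x :> D)"

definition hessian :: "(real^'n \<Rightarrow> real) \<Rightarrow> real^'n \<Rightarrow> real^'n^'n" where
  "hessian g x = jacobian (grad g) (at x)"

definition twice_continuously_differentiable :: "(real^'n \<Rightarrow> real) \<Rightarrow> bool" where
  "twice_continuously_differentiable g \<longleftrightarrow>
     (\<forall>x. g differentiable (at x)) \<and>
     (\<forall>x. grad g differentiable (at x)) \<and>
     continuous_on UNIV (hessian g)"

text \<open>
  The operator norm is spelled out with \<open>onorm\<close>, because \<open>norm\<close> on \<open>real^'n^'n\<close> is the
  Frobenius norm.
\<close>

definition hessian_lipschitz :: "real \<Rightarrow> (real^'n \<Rightarrow> real) \<Rightarrow> bool" where
  "hessian_lipschitz L g \<longleftrightarrow>
     (\<forall>x y. onorm (\<lambda>v. (hessian g x - hessian g y) *v v) \<le> L * norm (x - y))"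

text \<open>
  The merit function takes values in the extended reals, since its supremum may be infinite
  at a general point.
\<close>

definition merit :: "('m::finite \<Rightarrow> real^'n \<Rightarrow> real) \<Rightarrow> real^'n \<Rightarrow> ereal" where
  "merit f x = (SUP z. ereal (Min (range (\<lambda>i. f i x - f i z))))"

definition weakly_Pareto_optimal :: "('m \<Rightarrow> real^'n \<Rightarrow> real) \<Rightarrow> real^'n \<Rightarrow> bool" where
  "weakly_Pareto_optimal f x \<longleftrightarrow> \<not> (\<exists>y. \<forall>i. f i y < f i x)"

definition unit_simplex :: "(real^'m) set" where
  "unit_simplex = {l. (\<forall>i. 0 \<le> l $ i) \<and> (\<Sum>i\<in>UNIV. l $ i) = 1}"

text \<open>The infimum is a minimum, as the simplex is compact and nonempty.\<close>

definition stationarity :: "('m::finite \<Rightarrow> real^'n \<Rightarrow> real) \<Rightarrow> real^'n \<Rightarrow> real" where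
  "stationarity f x =
     (INF l\<in>unit_simplex. norm (\<Sum>i\<in>UNIV. l $ i *\<^sub>R grad (f i) x))"

definition quadratic_model :: "(real^'n \<Rightarrow> real) \<Rightarrow> real^'n \<Rightarrow> real^'n \<Rightarrow> real" where
  "quadratic_model g x d = grad g x \<bullet> d + 1/2 * (d \<bullet> (hessian g x *v d))"

definition newton_objective ::
    "('m::finite \<Rightarrow> real^'n \<Rightarrow> real) \<Rightarrow> real \<Rightarrow> real^'n \<Rightarrow> real^'n \<Rightarrow> real" where
  "newton_objective f H x d =
     (let \<eta> = 2 * sqrt (H * stationarity f x)
      in Max (range (\<lambda>i. quadratic_model (f i) x d)) + \<eta> / 2 * (norm d)\<^sup>2)"

text \<open>
  \<open>x\<close> is a run of the regularized Newton method from \<open>x0\<close>. Once an iterate with stationarity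
  measure 0 has been reached the method has stopped, and the later values of \<open>x\<close> are
  unconstrained padding.
\<close>

definition newton_run ::
    "('m::finite \<Rightarrow> real^'n \<Rightarrow> real) \<Rightarrow> real \<Rightarrow> real^'n \<Rightarrow> (nat \<Rightarrow> real^'n) \<Rightarrow> bool" where
  "newton_run f H x0 x \<longleftrightarrow>
     x 0 = x0 \<and>
     (\<forall>k. (\<forall>j\<le>k. stationarity f (x j) \<noteq> 0) \<longrightarrow>
        (\<exists>d. is_arg_min (newton_objective f H (x k)) (\<lambda>_. True) d \<and> x (Suc k) = x k + d))"

definition terminates_at ::
    "('m::finite \<Rightarrow> real^'n \<Rightarrow> real) \<Rightarrow> (nat \<Rightarrow> real^'n) \<Rightarrow> nat \<Rightarrow> bool" where
  "terminates_at f x N \<longleftrightarrow>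
     (\<forall>k<N. stationarity f (x k) \<noteq> 0) \<and> stationarity f (x N) = 0"

end

theory Submission
  imports Defs
begin

text \<open>
  Write \<open>s\<close> for the stationarity measure and \<open>U\<close> for the merit function. The optimality
  conditions of the subproblem give multipliers \<open>l\<close> on the active models with
  \<open>\<Sum>i. l i * (grad (f i) x + hessian (f i) x d) = - \<eta> d\<close>. Comparing them with the weights
  attaining \<open>s x\<close> yields \<open>\<eta> * norm d \<le> s x\<close>, so \<open>H * norm d \<le> \<eta> / 4\<close>, and then Taylor
  expansion gives \<open>s (x + d) \<le> 5/4 * \<eta> * norm d\<close> and a decrease of every objective by
  \<open>3/4 * \<eta> * (norm d)\<^sup>2\<close>. Since all objectives decrease simultaneously,
  \<open>U (k + 1) \<le> U k - c * (s (k + 1))\<^sup>2 / sqrt (s k)\<close>; in particular \<open>s k\<close> tends to 0.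

  Convexity and compactness of the level set alone give \<open>U k \<le> D * s k\<close>, which would yield only
  \<open>O(1/k\<^sup>2)\<close>. The improvement to \<open>o(1/k\<^sup>2)\<close> comes from \<open>U k / s k\<close> tending to 0.
\<close>

section \<open>Taylor expansions and the Hessian\<close>

text \<open>Legitimizes the definite description in \<open>grad\<close>: the Riesz vector of the
  derivative exists, as \<open>adjoint g' 1\<close>, and it is unique because derivatives
  are.\<close>

lemma has_derivative_grad:
  assumes "twice_continuously_differentiable g"
  shows "(g has_derivative (\<lambda>h. h \<bullet> grad g x)) (at x)"
proof -
  have "g differentiable (at x)"
    using assms by (simp add: twice_continuously_differentiable_def)
  then obtain g' where g': "(g has_derivative g') (at x)"
    by (auto simp: differentiable_def)
  then interpret linear g'
    by (rule has_derivative_linear)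
  have "g' = (\<lambda>h. h \<bullet> adjoint g' 1)"
    using adjoint_works[OF linear_axioms, of _ 1] by auto
  with g' have "GDERIV g x :> adjoint g' 1"
    unfolding gderiv_def by simp
  moreover have "D = D'" if "GDERIV g x :> D" "GDERIV g x :> D'" for D D'
  proof -
    have "(\<lambda>h. h \<bullet> D) = (\<lambda>h. h \<bullet> D')"
      using that unfolding gderiv_def by (rule has_derivative_unique)
    then show ?thesis
      by (intro vector_eq_ldot[THEN iffD1]) (auto dest: fun_cong)
  qed
  ultimately have "GDERIV g x :> grad g x"
    unfolding grad_def by (blast intro: theI)
  then show ?thesis
    by (simp add: gderiv_def)
qed

lemma grad_has_derivative:
  assumes "twice_continuously_differentiable g"
  shows "(grad g has_derivative (\<lambda>h. hessian g x *v h)) (at x)"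
  using assms jacobian_works[of "grad g" "at x"]
  by (simp add: twice_continuously_differentiable_def hessian_def)

lemma continuous_on_grad:
  assumes "twice_continuously_differentiable g"
  shows "continuous_on A (grad g)"
  using grad_has_derivative[OF assms]
  by (blast intro: continuous_at_imp_continuous_on has_derivative_continuous)

lemma continuous_on_twice_continuously_differentiable:
  assumes "twice_continuously_differentiable g"
  shows "continuous_on A g"
  using has_derivative_grad[OF assms]
  by (blast intro: continuous_at_imp_continuous_on has_derivative_continuous)

lemma has_real_derivative_along_line:
  assumes "twice_continuously_differentiable g"
  shows "((\<lambda>t. g (x + t *\<^sub>R d)) has_real_derivative d \<bullet> grad g (x + t *\<^sub>R d)) (at t)"
proof -
  have "((\<lambda>t. x + t *\<^sub>R d) has_derivative (\<lambda>h. h *\<^sub>R d)) (at t)"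
    by (auto intro!: derivative_eq_intros)
  from has_derivative_compose[OF this has_derivative_grad[OF assms]]
  show ?thesis
    unfolding has_field_derivative_def by (simp add: mult_commute_abs)
qed

text \<open>Restriction to \<open>x + t *\<^sub>R (y - x)\<close> reduces this to the tangent
  inequality for a convex function of one real variable.\<close>

lemma convex_on_gradient_inequality:
  assumes "twice_continuously_differentiable g" "convex_on UNIV g"
  shows "g x + grad g x \<bullet> (y - x) \<le> g y"
proof -
  define p where "p t = g (x + t *\<^sub>R (y - x))" for t :: real
  have "convex_on UNIV p"
  proof (rule convex_onI)
    fix t a b :: real
    assume "0 < t" "t < 1"
    have "x + ((1 - t) *\<^sub>R a + t *\<^sub>R b) *\<^sub>R (y - x) =
        (1 - t) *\<^sub>R (x + a *\<^sub>R (y - x)) + t *\<^sub>R (x + b *\<^sub>R (y - x))"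
      by (simp add: algebra_simps)
    then show "p ((1 - t) *\<^sub>R a + t *\<^sub>R b) \<le> (1 - t) * p a + t * p b"
      using convex_onD[OF assms(2), of t "x + a *\<^sub>R (y - x)" "x + b *\<^sub>R (y - x)"]
        \<open>0 < t\<close> \<open>t < 1\<close> by (simp add: p_def)
  qed simp
  moreover have "(p has_real_derivative (y - x) \<bullet> grad g x) (at 0)"
    using has_real_derivative_along_line[OF assms(1), of x "y - x" 0] by (simp add: p_def[abs_def])
  ultimately have "p 1 - p 0 \<ge> ((y - x) \<bullet> grad g x) * (1 - 0)"
    by (intro convex_on_imp_above_tangent[where A=UNIV]) auto
  then show ?thesis
    by (simp add: p_def inner_commute)
qed

text \<open>The sharp constant is \<open>L / 2\<close> here and \<open>L / 6\<close> in the expansion of \<open>g\<close> itself; the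
  choice \<open>\<eta> = 2 * sqrt (H * s)\<close> leaves enough room for the cruder ones.\<close>

lemma grad_expansion:
  assumes "twice_continuously_differentiable g" "hessian_lipschitz L g" "0 \<le> L"
  shows "norm (grad g (x + d) - grad g x - hessian g x *v d) \<le> L * (norm d)\<^sup>2"
proof -
  have "norm (grad g (x + d) - grad g x - hessian g x *v ((x + d) - x)) \<le>
      norm ((x + d) - x) * (L * norm d)"
  \<comment> \<open>Mean value inequality for the linearization error: throughout the ball of radius
    \<open>norm d\<close> the Hessian stays within \<open>L * norm d\<close> of its value at
    \<open>x\<close>.\<close>
  proof (rule differentiable_bound_linearization[where S="cball x (norm d)" and f'="\<lambda>y h. hessian g y *v h"])
    show "x + t *\<^sub>R (x + d - x) \<in> cball x (norm d)" if "t \<in> {0..1}" for t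
      using that by (simp add: dist_norm mult_left_le_one_le)
    show "(grad g has_derivative (*v) (hessian g y)) (at y within cball x (norm d))" for y
      using grad_has_derivative[OF assms(1)] has_derivative_at_withinI by blast
    show "onorm ((*v) (hessian g y) - (*v) (hessian g x)) \<le> L * norm d"
      if "y \<in> cball x (norm d)" for y
    proof -
      have "(*v) (hessian g y) - (*v) (hessian g x) = (\<lambda>v. (hessian g y - hessian g x) *v v)"
        by (auto simp: matrix_vector_mult_diff_rdistrib)
      then have "onorm ((*v) (hessian g y) - (*v) (hessian g x)) \<le> L * norm (y - x)"
        using assms(2) by (simp add: hessian_lipschitz_def)
      also have "\<dots> \<le> L * norm d"
        using that assms(3) by (intro mult_left_mono) (auto simp: dist_norm norm_minus_commute)
      finally show ?thesis .
    qed
  qed simp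
  then show ?thesis
    by (simp add: power2_eq_square mult_ac)
qed

lemma quadratic_model_expansion:
  assumes "twice_continuously_differentiable g" "hessian_lipschitz L g" "0 \<le> L"
  shows "\<bar>g (x + d) - g x - quadratic_model g x d\<bar> \<le> L * (norm d)^3"
proof -
  \<comment> \<open>\<open>p 1 - p 0\<close> is the error to be bounded, and \<open>p' t\<close> is
    \<open>d\<close> paired with the error of \<open>grad_expansion\<close> for the step
    \<open>t *\<^sub>R d\<close>, so a single mean value point suffices.\<close>
  define p where "p t = g (x + t *\<^sub>R d) - t * (grad g x \<bullet> d) - t\<^sup>2 / 2 * (d \<bullet> (hessian g x *v d))"
    for t :: real
  define p' where "p' t = d \<bullet> grad g (x + t *\<^sub>R d) - grad g x \<bullet> d - t * (d \<bullet> (hessian g x *v d))"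
    for t :: real
  have "(p has_real_derivative p' t) (at t)" for t
    unfolding p_def[abs_def] p'_def
    by (rule derivative_eq_intros has_real_derivative_along_line[OF assms(1)] refl | simp)+
  then obtain t where t: "0 < t" "t < 1" "p 1 - p 0 = (1 - 0) * p' t"
    using MVT2[of 0 1 p p'] by auto
  have "p' t = d \<bullet> (grad g (x + t *\<^sub>R d) - grad g x - hessian g x *v (t *\<^sub>R d))"
    by (simp add: p'_def inner_diff_right inner_commute matrix_vector_mult_scaleR)
  then have "\<bar>p' t\<bar> \<le> norm d * norm (grad g (x + t *\<^sub>R d) - grad g x - hessian g x *v (t *\<^sub>R d))"
    by (simp add: Cauchy_Schwarz_ineq2)
  also have "\<dots> \<le> norm d * (L * (norm (t *\<^sub>R d))\<^sup>2)"
    by (intro mult_left_mono grad_expansion[OF assms]) simp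
  also have "\<dots> \<le> norm d * (L * (norm d)\<^sup>2)"
    using t assms(3) by (intro mult_left_mono power_mono) (auto simp: mult_left_le_one_le)
  finally show ?thesis
    using t(3) by (simp add: p_def quadratic_model_def algebra_simps power2_eq_square power3_eq_cube)
qed

text \<open>Expand at \<open>x + u\<close> in direction \<open>v\<close>, then move gradient and
  Hessian back to \<open>x\<close>; the four errors are dominated by the terms of the expanded cube.
  Only the mixed term distinguishes \<open>u\<close> from \<open>v\<close>, which is what the
  symmetry of the Hessian rests on.\<close>

lemma second_order_expansion:
  assumes "twice_continuously_differentiable g" "hessian_lipschitz L g" "0 \<le> L"
  shows "\<bar>g (x + u + v) - g x - quadratic_model g x u - quadratic_model g x v
           - (hessian g x *v u) \<bullet> v\<bar> \<le> L * (norm u + norm v)^3"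
proof -
  define a b where "a = norm u" and "b = norm v"
  have ab: "0 \<le> a" "0 \<le> b"
    by (auto simp: a_def b_def)
  have e1: "\<bar>g (x + u + v) - g (x + u) - quadratic_model g (x + u) v\<bar> \<le> L * b^3"
    unfolding b_def using quadratic_model_expansion[OF assms] .
  have e2: "\<bar>g (x + u) - g x - quadratic_model g x u\<bar> \<le> L * a^3"
    unfolding a_def using quadratic_model_expansion[OF assms] .
  have "\<bar>(grad g (x + u) - grad g x - hessian g x *v u) \<bullet> v\<bar> \<le> L * a\<^sup>2 * b"
    unfolding a_def b_def
    by (rule order_trans[OF Cauchy_Schwarz_ineq2 mult_right_mono[OF grad_expansion[OF assms]]]) simp
  then have e3: "\<bar>grad g (x + u) \<bullet> v - grad g x \<bullet> v - (hessian g x *v u) \<bullet> v\<bar> \<le> L * a\<^sup>2 * b"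
    by (simp add: inner_diff_left)
  have "norm ((hessian g (x + u) - hessian g x) *v v) \<le> onorm ((*v) (hessian g (x + u) - hessian g x)) * b"
    unfolding b_def by (rule onorm[OF matrix_vector_mul_bounded_linear])
  also have "\<dots> \<le> (L * a) * b"
    using assms(2) unfolding a_def b_def hessian_lipschitz_def
    by (intro mult_right_mono) (auto dest: spec2[of _ "x + u" x])
  finally have "\<bar>v \<bullet> ((hessian g (x + u) - hessian g x) *v v)\<bar> \<le> b * (L * a * b)"
    unfolding b_def by (intro order_trans[OF Cauchy_Schwarz_ineq2 mult_left_mono]) auto
  then have e4: "\<bar>v \<bullet> (hessian g (x + u) *v v) - v \<bullet> (hessian g x *v v)\<bar> \<le> L * a * b\<^sup>2"
    by (simp add: matrix_vector_mult_diff_rdistrib inner_diff_right power2_eq_square mult_ac)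
  have "\<bar>g (x + u + v) - g x - quadratic_model g x u - quadratic_model g x v
           - (hessian g x *v u) \<bullet> v\<bar> \<le> L * b^3 + L * a^3 + L * a\<^sup>2 * b + L * a * b\<^sup>2"
    using e1 e2 e3 e4 unfolding quadratic_model_def by argo
  also have "\<dots> = L * (b^3 + a^3 + a\<^sup>2 * b + a * b\<^sup>2)"
    by (simp add: algebra_simps)
  also have "\<dots> \<le> L * (a + b)^3"
  proof -
    have "(a + b)^3 = b^3 + a^3 + a\<^sup>2 * b + a * b\<^sup>2 + 2 * (a\<^sup>2 * b) + 2 * (a * b\<^sup>2)"
      by (simp add: power2_eq_square power3_eq_cube algebra_simps)
    moreover have "0 \<le> a\<^sup>2 * b" "0 \<le> a * b\<^sup>2"
      using ab by auto
    ultimately show ?thesis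
      using assms(3) by (intro mult_left_mono) linarith+
  qed
  finally show ?thesis
    by (simp add: a_def b_def)
qed

lemma le_zero_if_le_linear:
  fixes a C :: real
  assumes "\<And>t. 0 < t \<Longrightarrow> a \<le> C * t"
  shows "a \<le> 0"
proof -
  have "((\<lambda>t. C * t) \<longlongrightarrow> C * 0) (at_right 0)"
    by (intro tendsto_intros)
  then show ?thesis
    using assms by (intro tendsto_lowerbound[of _ "0" "at_right 0"])
      (auto simp: eventually_at_right_less intro: eventually_at_rightI[of 0 1])
qed

text \<open>The expansion of \<open>g (x + t u + t v)\<close> is symmetric in \<open>u\<close> and \<open>v\<close> up to
  \<open>O(t\<^sup>3)\<close>, except for the mixed term.\<close>

lemma hessian_symmetric:
  assumes "twice_continuously_differentiable g" "hessian_lipschitz L g" "0 \<le> L"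
  shows "(hessian g x *v u) \<bullet> v = (hessian g x *v v) \<bullet> u"
proof -
  define \<delta> where "\<delta> = \<bar>(hessian g x *v u) \<bullet> v - (hessian g x *v v) \<bullet> u\<bar>"
  have "\<delta> \<le> 2 * L * (norm u + norm v)^3 * t" if "0 < t" for t
  proof -
    have 1: "\<bar>g (x + t *\<^sub>R u + t *\<^sub>R v) - g x - quadratic_model g x (t *\<^sub>R u) - quadratic_model g x (t *\<^sub>R v)
           - t\<^sup>2 * ((hessian g x *v u) \<bullet> v)\<bar> \<le> L * (norm u + norm v)^3 * t^3" for u v
    proof -
      have "norm (t *\<^sub>R u) + norm (t *\<^sub>R v) = t * (norm u + norm v)"
        using that by (simp add: algebra_simps)
      then show ?thesis
        using second_order_expansion[OF assms, of x "t *\<^sub>R u" "t *\<^sub>R v"]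
        by (simp add: matrix_vector_mult_scaleR power_mult_distrib mult_ac power2_eq_square)
    qed
    have "t\<^sup>2 * \<delta> = \<bar>t\<^sup>2 * ((hessian g x *v u) \<bullet> v) - t\<^sup>2 * ((hessian g x *v v) \<bullet> u)\<bar>"
      by (simp add: \<delta>_def abs_mult flip: right_diff_distrib)
    also have "\<dots> \<le> 2 * (L * (norm u + norm v)^3 * t^3)"
    proof -
      have eq: "x + t *\<^sub>R v + t *\<^sub>R u = x + t *\<^sub>R u + t *\<^sub>R v" "norm v + norm u = norm u + norm v"
        by simp_all
      show ?thesis
        using 1[of u v] 1[of v u] unfolding eq by linarith
    qed
    also have "\<dots> = t\<^sup>2 * (2 * L * (norm u + norm v)^3 * t)"
      by (simp add: power2_eq_square power3_eq_cube)
    finally show ?thesis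
      using that by simp
  qed
  then have "\<delta> \<le> 0"
    by (rule le_zero_if_le_linear)
  then show ?thesis
    by (simp add: \<delta>_def)
qed

text \<open>Compare the gradient inequality with the cubic Taylor bound at
  \<open>x + t *\<^sub>R d\<close>: the first-order terms cancel, and after division by
  \<open>t\<^sup>2 / 2\<close> only an error linear in \<open>t\<close> remains.\<close>

lemma hessian_nonneg:
  assumes "twice_continuously_differentiable g" "hessian_lipschitz L g" "0 \<le> L" "convex_on UNIV g"
  shows "0 \<le> d \<bullet> (hessian g x *v d)"
proof -
  have "- (d \<bullet> (hessian g x *v d)) \<le> 2 * L * (norm d)^3 * t" if "0 < t" for t
  proof -
    have "g x + grad g x \<bullet> (t *\<^sub>R d) \<le> g (x + t *\<^sub>R d)"
      using convex_on_gradient_inequality[OF assms(1,4), of x "x + t *\<^sub>R d"] by simp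
    moreover have "\<bar>g (x + t *\<^sub>R d) - g x - quadratic_model g x (t *\<^sub>R d)\<bar> \<le> L * (norm (t *\<^sub>R d))^3"
      by (rule quadratic_model_expansion[OF assms(1-3)])
    ultimately have "0 \<le> quadratic_model g x (t *\<^sub>R d) - grad g x \<bullet> (t *\<^sub>R d) + L * (norm (t *\<^sub>R d))^3"
      by linarith
    also have "\<dots> = t\<^sup>2 / 2 * (d \<bullet> (hessian g x *v d) + 2 * L * (norm d)^3 * t)"
      using that by (simp add: quadratic_model_def matrix_vector_mult_scaleR power_mult_distrib
          power2_eq_square power3_eq_cube algebra_simps)
    finally show ?thesis
      using that by (simp add: zero_le_mult_iff)
  qed
  then have "- (d \<bullet> (hessian g x *v d)) \<le> 0"
    by (rule le_zero_if_le_linear)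
  then show ?thesis
    by simp
qed

section \<open>Convex combinations and stationarity\<close>

lemma unit_simplex_nonneg: "l \<in> unit_simplex \<Longrightarrow> 0 \<le> l $ i"
  and unit_simplex_sum: "l \<in> unit_simplex \<Longrightarrow> (\<Sum>i\<in>UNIV. l $ i) = 1"
  by (simp_all add: unit_simplex_def)

lemma axis_in_unit_simplex: "axis i 1 \<in> unit_simplex"
  by (simp add: unit_simplex_def axis_def)

lemma convex_unit_simplex: "convex unit_simplex"
  unfolding convex_def unit_simplex_def
  by (simp add: sum.distrib flip: sum_distrib_left)

lemma compact_unit_simplex: "compact (unit_simplex :: (real^'m) set)"
  unfolding compact_eq_bounded_closed
proof
  have "norm l \<le> 1" if "l \<in> unit_simplex" for l :: "real^'m"
    using norm_le_l1_cart[of l] that by (simp add: unit_simplex_def)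
  then show "bounded (unit_simplex :: (real^'m) set)"
    by (auto intro: boundedI)
  show "closed (unit_simplex :: (real^'m) set)"
    unfolding unit_simplex_def Collect_conj_eq Collect_all_eq
    by (intro closed_Int closed_INT ballI closed_Collect_le closed_Collect_eq continuous_intros)
qed

lemma unit_simplex_average_le:
  assumes "l \<in> unit_simplex" "\<And>i. a i \<le> (b::real)"
  shows "(\<Sum>i\<in>UNIV. l $ i * a i) \<le> b"
proof -
  have "(\<Sum>i\<in>UNIV. l $ i * a i) \<le> (\<Sum>i\<in>UNIV. l $ i * b)"
    using assms by (intro sum_mono mult_left_mono) (auto simp: unit_simplex_nonneg)
  also have "\<dots> = b"
    using assms(1) by (simp add: unit_simplex_sum flip: sum_distrib_right)
  finally show ?thesis .
qed

lemma unit_simplex_average_ge: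
  assumes "l \<in> unit_simplex" "\<And>i. (b::real) \<le> a i"
  shows "b \<le> (\<Sum>i\<in>UNIV. l $ i * a i)"
  using unit_simplex_average_le[OF assms(1), of "\<lambda>i. - a i" "- b"] assms(2)
  by (simp add: sum_negf)

text \<open>Gordan's alternative. The convex hull of the \<open>a i\<close> with \<open>i\<close> in
  \<open>A\<close> is the linear image of a compact face of the simplex, hence closed; if it misses
  0, a hyperplane separates it strictly from 0.\<close>

lemma gordan_alternative:
  fixes a :: "'m::finite \<Rightarrow> 'a::euclidean_space"
  assumes "A \<noteq> {}"
  shows "(\<exists>l\<in>unit_simplex. (\<forall>i. i \<notin> A \<longrightarrow> l $ i = 0) \<and> (\<Sum>i\<in>UNIV. l $ i *\<^sub>R a i) = 0) \<or>
         (\<exists>v. \<forall>i\<in>A. 0 < v \<bullet> a i)"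
proof -
  define S where "S = unit_simplex \<inter> {l :: real^'m. \<forall>i. i \<notin> A \<longrightarrow> l $ i = 0}"
  define T where "T l = (\<Sum>i\<in>UNIV. l $ i *\<^sub>R a i)" for l :: "real^'m"
  have "linear T"
    unfolding T_def[abs_def]
    by (intro linearI) (auto simp: sum.distrib scaleR_left_distrib scaleR_sum_right)
  have "closed {l :: real^'m. \<forall>i. i \<notin> A \<longrightarrow> l $ i = 0}"
    unfolding Collect_all_eq
    by (intro closed_INT ballI closed_Collect_imp closed_Collect_eq continuous_intros) simp
  then have "compact S"
    unfolding S_def by (intro compact_Int_closed compact_unit_simplex)
  moreover have "convex S"
    unfolding S_def by (intro convex_Int convex_unit_simplex) (simp add: convex_def)
  ultimately have T: "convex (T ` S)" "closed (T ` S)"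
    using \<open>linear T\<close>
    by (auto intro!: convex_linear_image compact_imp_closed compact_continuous_image
        linear_continuous_on simp: linear_conv_bounded_linear)
  show ?thesis
  proof (cases "0 \<in> T ` S")
    case True
    then show ?thesis
      by (force simp: S_def T_def)
  next
    case False
    then obtain v b where v: "0 < b" "\<And>y. y \<in> T ` S \<Longrightarrow> b < v \<bullet> y"
      using separating_hyperplane_closed_0[OF T] by blast
    have "a i \<in> T ` S" if "i \<in> A" for i
    proof
      show "a i = T (axis i 1)"
        by (simp add: T_def axis_def if_distrib[of "\<lambda>c. c *\<^sub>R _"] cong: if_cong)
      show "axis i 1 \<in> S"
        using that axis_in_unit_simplex[of i] by (auto simp: S_def axis_def)
    qed
    then show ?thesis
      using v by (meson less_trans)
  qed
qed

lemma stationarity_nonneg: "0 \<le> stationarity f x"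
  unfolding stationarity_def using axis_in_unit_simplex by (intro cINF_greatest) auto

lemma stationarity_le:
  assumes "l \<in> unit_simplex"
  shows "stationarity f x \<le> norm (\<Sum>i\<in>UNIV. l $ i *\<^sub>R grad (f i) x)"
  unfolding stationarity_def using assms by (intro cINF_lower) (auto intro: bdd_belowI[of _ 0])

lemma stationarity_attained:
  obtains l where "l \<in> unit_simplex"
    "stationarity f x = norm (\<Sum>i\<in>UNIV. l $ i *\<^sub>R grad (f i) x)"
proof -
  have "\<exists>l\<in>unit_simplex. \<forall>k\<in>unit_simplex. norm (\<Sum>i\<in>UNIV. l $ i *\<^sub>R grad (f i) x) \<le>
      norm (\<Sum>i\<in>UNIV. k $ i *\<^sub>R grad (f i) x)"
    using axis_in_unit_simplex
    by (intro continuous_attains_inf compact_unit_simplex continuous_intros) auto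
  then obtain l where l: "l \<in> unit_simplex"
    "\<And>k. k \<in> unit_simplex \<Longrightarrow> norm (\<Sum>i\<in>UNIV. l $ i *\<^sub>R grad (f i) x) \<le>
      norm (\<Sum>i\<in>UNIV. k $ i *\<^sub>R grad (f i) x)"
    by blast
  have "norm (\<Sum>i\<in>UNIV. l $ i *\<^sub>R grad (f i) x) \<le> stationarity f x"
    unfolding stationarity_def using l by (intro cINF_greatest) auto
  then show thesis
    using that[OF l(1)] stationarity_le[OF l(1), of f x] by simp
qed

text \<open>The link between objective gaps and stationarity: for weights attaining the measure,
  Cauchy-Schwarz bounds the right-hand side by
  \<open>stationarity f x * norm (x - y)\<close>.\<close>

lemma weighted_gradient_inequality:
  assumes "\<And>i. twice_continuously_differentiable (f i)" "\<And>i. convex_on UNIV (f i)"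
    and "l \<in> unit_simplex"
  shows "(\<Sum>i\<in>UNIV. l $ i * (f i x - f i y)) \<le> (\<Sum>i\<in>UNIV. l $ i *\<^sub>R grad (f i) x) \<bullet> (x - y)"
proof -
  have "f i x - f i y \<le> grad (f i) x \<bullet> (x - y)" for i
    using convex_on_gradient_inequality[OF assms(1,2), of i x y] by (simp add: inner_diff_right)
  then have "(\<Sum>i\<in>UNIV. l $ i * (f i x - f i y)) \<le> (\<Sum>i\<in>UNIV. l $ i * (grad (f i) x \<bullet> (x - y)))"
    using assms(3) by (intro sum_mono mult_left_mono) (auto simp: unit_simplex_nonneg)
  then show ?thesis
    by (simp add: inner_sum_left)
qed

lemma stationary_imp_weakly_Pareto_optimal:
  assumes "\<And>i. twice_continuously_differentiable (f i)" "\<And>i. convex_on UNIV (f i)"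
    and "stationarity f x = 0"
  shows "weakly_Pareto_optimal f x"
  unfolding weakly_Pareto_optimal_def
proof
  assume "\<exists>y. \<forall>i. f i y < f i x"
  then obtain y where y: "\<And>i. f i y < f i x"
    by blast
  obtain l where l: "l \<in> unit_simplex" "(\<Sum>i\<in>UNIV. l $ i *\<^sub>R grad (f i) x) = 0"
    using stationarity_attained[of f x] assms(3) by (metis norm_eq_zero)
  \<comment> \<open>If all objectives improved at \<open>y\<close>, every weighted average of the
    gaps would be at least \<open>b > 0\<close>, yet the weights \<open>l\<close> annihilate the
    gradients and force an average of at most 0.\<close>
  define b where "b = Min (range (\<lambda>i. f i x - f i y))"
  have "0 < b"
    using y by (simp add: b_def)
  also have "b \<le> (\<Sum>i\<in>UNIV. l $ i * (f i x - f i y))"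
    by (rule unit_simplex_average_ge[OF l(1)]) (simp add: b_def)
  also have "\<dots> \<le> 0"
    using weighted_gradient_inequality[of f l x y, OF assms(1,2) l(1)] l(2) by simp
  finally show False
    by simp
qed

section \<open>One regularized Newton step\<close>

text \<open>Symmetry of the Hessian merges the two mixed terms, so the linear coefficient is the
  gradient of the model at \<open>d\<close>.\<close>

lemma quadratic_model_diff:
  assumes "twice_continuously_differentiable g" "hessian_lipschitz L g" "0 \<le> L"
  shows "quadratic_model g x (d - t *\<^sub>R v) =
    quadratic_model g x d - t * (v \<bullet> (grad g x + hessian g x *v d)) + t\<^sup>2 * (v \<bullet> (hessian g x *v v) / 2)"
  using hessian_symmetric[OF assms, of x d v]
  by (simp add: quadratic_model_def matrix_vector_mult_diff_distrib matrix_vector_mult_scaleR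
      inner_commute algebra_simps power2_eq_square)

text \<open>First-order optimality for a maximum of smooth functions. Without such multipliers
  Gordan's alternative gives \<open>v\<close> such that a small step along \<open>- v\<close>
  strictly lowers all active regularized models, while the inactive ones stay below the maximum by
  continuity; this contradicts minimality of \<open>d\<close>.\<close>

lemma newton_multipliers:
  assumes f: "\<And>i. twice_continuously_differentiable (f i)" "\<And>i. hessian_lipschitz H (f i)" "0 \<le> H"
    and d: "is_arg_min (newton_objective f H x) (\<lambda>_. True) d"
  obtains l where "l \<in> unit_simplex"
    "\<And>i. l $ i \<noteq> 0 \<Longrightarrow> quadratic_model (f i) x d = Max (range (\<lambda>i. quadratic_model (f i) x d))"
    "(\<Sum>i\<in>UNIV. l $ i *\<^sub>R (grad (f i) x + hessian (f i) x *v d)) =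
      - (2 * sqrt (H * stationarity f x)) *\<^sub>R d"
proof -
  define \<eta> where "\<eta> = 2 * sqrt (H * stationarity f x)"
  define M where "M = Max (range (\<lambda>i. quadratic_model (f i) x d))"
  define A where "A = {i. quadratic_model (f i) x d = M}"
  \<comment> \<open>\<open>a i\<close> is the gradient at \<open>d\<close> of the
    \<open>i\<close>-th regularized model.\<close>
  define a where "a i = grad (f i) x + hessian (f i) x *v d + \<eta> *\<^sub>R d" for i
  have "M \<in> range (\<lambda>i. quadratic_model (f i) x d)"
    unfolding M_def by (intro Max_in) auto
  then have "A \<noteq> {}"
    by (auto simp: A_def)
  moreover have False if v: "\<And>i. i \<in> A \<Longrightarrow> 0 < v \<bullet> a i" for v
  proof -
    define \<phi> where "\<phi> i t = quadratic_model (f i) x (d - t *\<^sub>R v) + \<eta> / 2 * (norm (d - t *\<^sub>R v))\<^sup>2" for i t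
    define c where "c i = v \<bullet> (hessian (f i) x *v v) / 2 + \<eta> / 2 * (v \<bullet> v)" for i
    define F where "F = M + \<eta> / 2 * (norm d)\<^sup>2"
    have norm: "(norm (d - t *\<^sub>R v))\<^sup>2 = (norm d)\<^sup>2 - 2 * t * (v \<bullet> d) + t\<^sup>2 * (v \<bullet> v)" for t
      unfolding power2_norm_eq_inner
      by (simp add: inner_diff_left inner_diff_right inner_commute[of d v] power2_eq_square algebra_simps)
    have expand: "q - t * p + t\<^sup>2 * w + e / 2 * (n - 2 * t * z + t\<^sup>2 * y) =
        q + e / 2 * n - t * (p + e * z - t * (w + e / 2 * y))" for q t p w e n z y :: real
      by (simp add: algebra_simps power2_eq_square)
    have \<phi>0: "\<phi> i 0 = quadratic_model (f i) x d + \<eta> / 2 * (norm d)\<^sup>2" for i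
      by (simp add: \<phi>_def)
    have \<phi>: "\<phi> i t = \<phi> i 0 - t * (v \<bullet> a i - t * c i)" for i t
      unfolding \<phi>0
      unfolding \<phi>_def c_def a_def quadratic_model_diff[OF f] norm inner_add_right inner_scaleR_right
      by (rule expand)
    have "\<forall>\<^sub>F t in at_right 0. \<phi> i t < F" for i
    proof (cases "i \<in> A")
      case True
      have "((\<lambda>t. v \<bullet> a i - t * c i) \<longlongrightarrow> v \<bullet> a i - 0 * c i) (at_right 0)"
        by (intro tendsto_intros)
      then have "\<forall>\<^sub>F t in at_right 0. 0 < v \<bullet> a i - t * c i"
        using v[OF True] by (auto dest: order_tendstoD)
      moreover have "\<forall>\<^sub>F t in at_right (0::real). 0 < t"
        by (simp add: eventually_at_right_less)
      ultimately show ?thesis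
      proof eventually_elim
        case (elim t)
        then have "0 < t * (v \<bullet> a i - t * c i)"
          by simp
        moreover have "\<phi> i 0 = F"
          using True by (simp add: \<phi>_def F_def A_def)
        ultimately show ?case
          using \<phi>[of i t] by linarith
      qed
    next
      case False
      then have "\<phi> i 0 < F"
        unfolding A_def F_def \<phi>_def M_def by (simp add: less_le)
      moreover have "(\<phi> i \<longlongrightarrow> \<phi> i 0) (at_right 0)"
      proof -
        have "((\<lambda>t. \<phi> i 0 - t * (v \<bullet> a i - t * c i)) \<longlongrightarrow> \<phi> i 0 - 0 * (v \<bullet> a i - 0 * c i)) (at_right 0)"
          by (intro tendsto_intros)
        moreover have "\<phi> i = (\<lambda>t. \<phi> i 0 - t * (v \<bullet> a i - t * c i))"
          by (rule ext) (rule \<phi>)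
        ultimately show ?thesis
          by simp
      qed
      ultimately show ?thesis
        by (simp add: order_tendstoD)
    qed
    then have "\<forall>\<^sub>F t in at_right 0. \<forall>i. \<phi> i t < F"
      by (rule eventually_all_finite)
    then obtain t where t: "\<And>i. \<phi> i t < F"
      using eventually_happens'[of "at_right (0::real)"] by fastforce
    have "Max (range (\<lambda>i. quadratic_model (f i) x (d - t *\<^sub>R v))) < F - \<eta> / 2 * (norm (d - t *\<^sub>R v))\<^sup>2"
      using t by (subst Max_less_iff) (auto simp: \<phi>_def less_diff_eq)
    then have "newton_objective f H x (d - t *\<^sub>R v) < newton_objective f H x d"
      unfolding newton_objective_def Let_def F_def M_def \<eta>_def by linarith
    then show False
      using d by (simp add: is_arg_min_def)
  qed
  ultimately obtain l where l: "l \<in> unit_simplex" "\<And>i. i \<notin> A \<Longrightarrow> l $ i = 0" "(\<Sum>i\<in>UNIV. l $ i *\<^sub>R a i) = 0"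
    using gordan_alternative[of A a] by blast
  have "(\<Sum>i\<in>UNIV. l $ i *\<^sub>R a i) =
      (\<Sum>i\<in>UNIV. l $ i *\<^sub>R (grad (f i) x + hessian (f i) x *v d)) + (\<Sum>i\<in>UNIV. l $ i) *\<^sub>R \<eta> *\<^sub>R d"
    by (simp only: a_def scaleR_right_distrib[of _ _ "\<eta> *\<^sub>R d"] sum.distrib scaleR_sum_left)
  then have "(\<Sum>i\<in>UNIV. l $ i *\<^sub>R (grad (f i) x + hessian (f i) x *v d)) = - \<eta> *\<^sub>R d"
    using l(3) unit_simplex_sum[OF l(1)] by (simp add: eq_neg_iff_add_eq_0)
  then show thesis
    using l by (intro that[of l]) (auto simp: A_def M_def \<eta>_def)
qed

lemma newton_step_decrease:
  assumes f: "\<And>i. twice_continuously_differentiable (f i)" "\<And>i. hessian_lipschitz H (f i)"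
      "\<And>i. convex_on UNIV (f i)"
    and H: "0 < H" and s: "stationarity f x \<noteq> 0"
    and d: "is_arg_min (newton_objective f H x) (\<lambda>_. True) d"
  shows "f i (x + d) \<le> f i x - (stationarity f (x + d))\<^sup>2 / (5 * sqrt (H * stationarity f x))"
proof -
  define s where "s = stationarity f x"
  define s' where "s' = stationarity f (x + d)"
  define \<eta> where "\<eta> = 2 * sqrt (H * s)"
  define r where "r = norm d"
  define M where "M = Max (range (\<lambda>i. quadratic_model (f i) x d))"
  have "0 < s"
    using assms(5) stationarity_nonneg[of f x] by (simp add: s_def)
  then have \<eta>: "0 < \<eta>" "\<eta> * \<eta> = 4 * (H * s)"
    using H by (simp_all add: \<eta>_def)
  have "0 \<le> r"
    by (simp add: r_def)
  have H0: "0 \<le> H"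
    using H by simp
  have M: "quadratic_model (f i) x d \<le> M" for i
    by (simp add: M_def)
  have psd: "0 \<le> d \<bullet> (hessian (f i) x *v d)" for i
    by (rule hessian_nonneg[OF f(1,2) H0 f(3)])
  obtain l where l: "l \<in> unit_simplex" "\<And>i. l $ i \<noteq> 0 \<Longrightarrow> quadratic_model (f i) x d = M"
    "(\<Sum>i\<in>UNIV. l $ i *\<^sub>R (grad (f i) x + hessian (f i) x *v d)) = - \<eta> *\<^sub>R d"
    using newton_multipliers[OF f(1,2) H0 d] unfolding M_def \<eta>_def s_def by blast
  \<comment> \<open>The multipliers live on models with value \<open>M\<close>, and by positive
    semidefiniteness each model at \<open>d\<close> is at most its gradient at \<open>d\<close>
    paired with \<open>d\<close>.\<close>
  have M_le: "M \<le> - \<eta> * r\<^sup>2"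
  proof -
    have "M = (\<Sum>i\<in>UNIV. l $ i * M)"
      using unit_simplex_sum[OF l(1)] by (simp flip: sum_distrib_right)
    also have "\<dots> \<le> (\<Sum>i\<in>UNIV. l $ i * ((grad (f i) x + hessian (f i) x *v d) \<bullet> d))"
    proof (rule sum_mono)
      fix i
      have "l $ i * M = l $ i * quadratic_model (f i) x d"
        using l(2) by fastforce
      also have "\<dots> \<le> l $ i * ((grad (f i) x + hessian (f i) x *v d) \<bullet> d)"
        using psd[of i] unit_simplex_nonneg[OF l(1)]
        by (intro mult_left_mono) (auto simp: quadratic_model_def inner_add_left inner_commute[of d])
      finally show "l $ i * M \<le> l $ i * ((grad (f i) x + hessian (f i) x *v d) \<bullet> d)" .
    qed
    also have "\<dots> = (\<Sum>i\<in>UNIV. l $ i *\<^sub>R (grad (f i) x + hessian (f i) x *v d)) \<bullet> d"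
      by (simp add: inner_sum_left)
    also have "\<dots> = - \<eta> * r\<^sup>2"
      unfolding l(3) by (simp add: r_def power2_norm_eq_inner)
    finally show ?thesis .
  qed
  \<comment> \<open>Dropping the nonnegative curvature leaves the linear parts; their average with
    the minimal-norm weights is at least \<open>- s * r\<close>.\<close>
  have M_ge: "- s * r \<le> M"
  proof -
    obtain \<mu> where \<mu>: "\<mu> \<in> unit_simplex" "s = norm (\<Sum>i\<in>UNIV. \<mu> $ i *\<^sub>R grad (f i) x)"
      unfolding s_def by (rule stationarity_attained)
    have "- s * r \<le> (\<Sum>i\<in>UNIV. \<mu> $ i *\<^sub>R grad (f i) x) \<bullet> d"
      using Cauchy_Schwarz_ineq2[of "\<Sum>i\<in>UNIV. \<mu> $ i *\<^sub>R grad (f i) x" d]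
      unfolding \<mu>(2) r_def by linarith
    also have "\<dots> = (\<Sum>i\<in>UNIV. \<mu> $ i * (grad (f i) x \<bullet> d))"
      by (simp add: inner_sum_left)
    also have "\<dots> \<le> M"
    proof (rule unit_simplex_average_le[OF \<mu>(1)])
      show "grad (f i) x \<bullet> d \<le> M" for i
        using M[of i] psd[of i] by (simp add: quadratic_model_def)
    qed
    finally show ?thesis .
  qed
  have "\<eta> * r \<le> s"
  proof (cases "r = 0")
    case True
    then show ?thesis
      using \<open>0 < s\<close> by simp
  next
    case False
    then have "0 < r"
      using \<open>0 \<le> r\<close> by simp
    moreover have "(\<eta> * r) * r \<le> s * r"
      using M_le M_ge by (simp add: power2_eq_square)
    ultimately show ?thesis
      using mult_right_le_imp_le by blast
  qed
  \<comment> \<open>This is where the choice of \<open>\<eta>\<close> enters: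
    \<open>\<eta> * \<eta> = 4 * (H * s)\<close> turns \<open>\<eta> * r \<le> s\<close> into
    control of the Taylor errors by the regularization.\<close>
  then have "\<eta> * (4 * H * r) \<le> \<eta> * \<eta>"
    unfolding \<eta>(2) using H by simp
  then have Hr: "4 * H * r \<le> \<eta>"
    using \<eta>(1) by simp
  have Hr2: "H * r\<^sup>2 \<le> \<eta> * r / 4"
    using mult_right_mono[OF Hr \<open>0 \<le> r\<close>] by (simp add: power2_eq_square)
  have Hr3: "H * r^3 \<le> \<eta> * r\<^sup>2 / 4"
    using mult_right_mono[OF Hr2 \<open>0 \<le> r\<close>] by (simp add: power2_eq_square power3_eq_cube)
  have "f i (x + d) \<le> f i x + quadratic_model (f i) x d + H * r^3"
    using quadratic_model_expansion[OF f(1,2) H0, of i x d] unfolding r_def by linarith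
  also have "\<dots> \<le> f i x - 3/4 * (\<eta> * r\<^sup>2)"
    using M[of i] M_le Hr3 by simp
  finally have decrease: "f i (x + d) \<le> f i x - 3/4 * (\<eta> * r\<^sup>2)" .
  have "s' \<le> norm (\<Sum>i\<in>UNIV. l $ i *\<^sub>R grad (f i) (x + d))"
    unfolding s'_def by (rule stationarity_le[OF l(1)])
  \<comment> \<open>The optimality condition is subtracted, so the new gradients contribute only
    their Taylor remainders and \<open>- \<eta> *\<^sub>R d\<close>.\<close>
  also have "(\<Sum>i\<in>UNIV. l $ i *\<^sub>R grad (f i) (x + d)) =
      (\<Sum>i\<in>UNIV. l $ i *\<^sub>R (grad (f i) (x + d) - grad (f i) x - hessian (f i) x *v d)) - \<eta> *\<^sub>R d"
    using l(3) by (simp add: algebra_simps sum.distrib sum_subtractf)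
  also have "norm \<dots> \<le> H * r\<^sup>2 + \<eta> * r"
  proof -
    have "norm (\<Sum>i\<in>UNIV. l $ i *\<^sub>R (grad (f i) (x + d) - grad (f i) x - hessian (f i) x *v d))
        \<le> (\<Sum>i\<in>UNIV. l $ i * norm (grad (f i) (x + d) - grad (f i) x - hessian (f i) x *v d))"
      using norm_sum[of "\<lambda>i. l $ i *\<^sub>R (grad (f i) (x + d) - grad (f i) x - hessian (f i) x *v d)" UNIV]
        unit_simplex_nonneg[OF l(1)] by simp
    also have "\<dots> \<le> H * r\<^sup>2"
      unfolding r_def
      by (intro unit_simplex_average_le[OF l(1)] grad_expansion[OF f(1,2) H0])
    finally show ?thesis
      using \<eta>(1) by (intro order_trans[OF norm_triangle_ineq4]) (simp add: r_def)
  qed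
  finally have "s' \<le> 5/4 * (\<eta> * r)"
    using Hr2 by simp
  then have "s'\<^sup>2 \<le> (5/4 * (\<eta> * r))\<^sup>2"
    by (intro power_mono) (auto simp: s'_def stationarity_nonneg)
  \<comment> \<open>The factor \<open>2 / (5 * \<eta>)\<close> equals
    \<open>1 / (5 * sqrt (H * s))\<close>; it makes the right-hand side
    \<open>5/8 * (\<eta> * r\<^sup>2)\<close>, which fits into the decrease.\<close>
  then have "2 / (5 * \<eta>) * s'\<^sup>2 \<le> 2 / (5 * \<eta>) * (5/4 * (\<eta> * r))\<^sup>2"
    using \<eta>(1) by (intro mult_left_mono) auto
  also have "\<dots> = 5/8 * (\<eta> * r\<^sup>2)"
    using \<eta>(1) by (simp add: power2_eq_square field_simps)
  also have "\<dots> \<le> 3/4 * (\<eta> * r\<^sup>2)"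
    using \<eta>(1) by simp
  also have "2 / (5 * \<eta>) * s'\<^sup>2 = s'\<^sup>2 / (5 * sqrt (H * s))"
    by (simp add: \<eta>_def)
  finally show ?thesis
    using decrease by (simp add: s_def s'_def)
qed

section \<open>The rate recursion\<close>

text \<open>Put \<open>u = 1 / sqrt U\<close>. The decrease of \<open>U\<close> bounds \<open>u (k + 1) - u k\<close> below by
  \<open>\<tau> X\<close>, and \<open>X \<ge> 1 + ln X\<close>; in \<open>ln X\<close> everything telescopes except a multiple of
  \<open>ln (s / U)\<close>, which tends to infinity. Hence \<open>u\<close> minus the telescoping part grows by at
  least \<open>\<tau>\<close> in every late step, for each \<open>\<tau>\<close>.\<close>

lemma inverse_sqrt_growth:
  fixes s U :: "nat \<Rightarrow> real"
  assumes s: "\<And>k. 0 < s k" and U: "\<And>k. 0 < U k" and c: "0 < c" and \<tau>: "0 < \<tau>"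
    and step: "\<And>k. U (Suc k) \<le> U k - c * (s (Suc k))\<^sup>2 / sqrt (s k)"
    and ratio: "(\<lambda>k. U k / s k) \<longlonglongrightarrow> 0"
  shows "\<forall>\<^sub>F k in sequentially. \<tau> * real k \<le> 4 / sqrt (U k)"
proof -
  define u where "u k = 1 / sqrt (U k)" for k
  define \<Phi> where "\<Phi> k = u k - \<tau> * (ln (s k) / 2 + ln (U k))" for k
  \<comment> \<open>In a step, \<open>ln X\<close> exceeds the telescoping difference by
    \<open>ln (c / (2 * \<tau>))\<close> plus 3/2 of \<open>ln (s / U)\<close> at
    \<open>Suc k\<close>; the exponential makes this surplus nonnegative. The bound 1 ensures
    \<open>U k \<le> s k\<close>.\<close>
  define \<epsilon> where "\<epsilon> = min 1 (exp (2 / 3 * ln (c / (2 * \<tau>))))"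
  have u: "0 < u k" "ln (u k) = - ln (U k) / 2" for k
    using U[of k] by (simp_all add: u_def ln_div ln_sqrt)
  have "0 < \<epsilon>"
    by (simp add: \<epsilon>_def)
  then obtain K where K: "\<And>k. K \<le> k \<Longrightarrow> U k / s k < \<epsilon>"
    using order_tendstoD(2)[OF ratio] by (auto simp: eventually_sequentially)
  have ln_ratio: "ln (U k) - ln (s k) \<le> 2 / 3 * ln (c / (2 * \<tau>))" "ln (U k) - ln (s k) \<le> 0"
    if "K \<le> k" for k
  proof -
    have "ln (U k / s k) \<le> ln \<epsilon>"
      using K[OF that] U[of k] s[of k] \<open>0 < \<epsilon>\<close> by (subst ln_le_cancel_iff) auto
    moreover have "ln \<epsilon> \<le> 2 / 3 * ln (c / (2 * \<tau>))" "ln \<epsilon> \<le> 0"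
      using \<open>0 < \<epsilon>\<close> by (auto simp: \<epsilon>_def min_def)
    ultimately show "ln (U k) - ln (s k) \<le> 2 / 3 * ln (c / (2 * \<tau>))" "ln (U k) - ln (s k) \<le> 0"
      using U[of k] s[of k] unfolding ln_divide_pos[OF U[of k] s[of k]] by linarith+
  qed
  have \<Phi>_step: "\<Phi> k + \<tau> \<le> \<Phi> (Suc k)" if "K \<le> k" for k
  proof -
    define a b where "a = sqrt (U k)" and "b = sqrt (U (Suc k))"
    \<comment> \<open>Normalized so that \<open>\<tau> * X\<close> is the guaranteed decrease of
      \<open>U\<close> over \<open>2 * a * a * b\<close>. That decrease is at most
      \<open>(a - b) * (a + b) \<le> 2 * a * (a - b)\<close>, which leaves
      \<open>1 / b - 1 / a\<close>.\<close>
    define X where "X = c / (2 * \<tau>) * (s (Suc k))\<^sup>2 / (sqrt (s k) * U k * sqrt (U (Suc k)))"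
    have ab: "0 < a" "0 < b" "U k = a * a" "U (Suc k) = b * b"
      using U[of k] U[of "Suc k"] by (simp_all add: a_def b_def)
    define w where "w = c * (s (Suc k))\<^sup>2 / sqrt (s k)"
    have decr: "w \<le> a * a - b * b"
      using step[of k] by (simp add: ab w_def)
    moreover have "0 \<le> w"
      using c s[of k] by (simp add: w_def)
    ultimately have "b * b \<le> a * a"
      by linarith
    then have "b \<le> a"
      using ab by (auto intro: power2_le_imp_le simp: power2_eq_square)
    have "0 < X"
      unfolding X_def using c \<tau> s[of k] s[of "Suc k"] U[of k] U[of "Suc k"] by simp
    have "\<tau> * X = w / (2 * a * a * b)"
      using \<tau> by (simp add: X_def ab(3) w_def flip: b_def)
    also have "\<dots> \<le> (a * a - b * b) / (2 * a * a * b)"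
      using ab decr by (intro divide_right_mono) auto
    also have "\<dots> = (a - b) * (a + b) / (2 * a * a * b)"
      by (simp add: algebra_simps)
    also have "\<dots> \<le> (a - b) * (2 * a) / (2 * a * a * b)"
      using ab \<open>b \<le> a\<close> by (intro divide_right_mono mult_left_mono) auto
    also have "\<dots> = u (Suc k) - u k"
      using ab(1,2) by (simp add: u_def field_simps flip: a_def b_def)
    finally have "\<tau> * X \<le> u (Suc k) - u k" .
    moreover have "\<tau> * (1 + ln X) \<le> \<tau> * X"
      using \<tau> ln_le_minus_one[OF \<open>0 < X\<close>] by simp
    moreover have "ln X = ln (c / (2 * \<tau>)) + 2 * ln (s (Suc k)) - (ln (s k) / 2 + ln (U k) + ln (U (Suc k)) / 2)"
      unfolding X_def using c \<tau> s[of k] s[of "Suc k"] U[of k] U[of "Suc k"]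
      by (simp add: ln_div ln_mult ln_sqrt ln_realpow)
    moreover have "\<tau> * (ln (s (Suc k)) / 2 + ln (U (Suc k)) - (ln (s k) / 2 + ln (U k))) \<le>
        \<tau> * (ln (c / (2 * \<tau>)) + 2 * ln (s (Suc k)) - (ln (s k) / 2 + ln (U k) + ln (U (Suc k)) / 2))"
      using ln_ratio(1)[of "Suc k"] that \<tau> by (intro mult_left_mono) auto
    ultimately show ?thesis
      unfolding \<Phi>_def by (simp add: algebra_simps)
  qed
  have \<Phi>_ge: "\<Phi> K + \<tau> * (real k - real K) \<le> \<Phi> k" if "K \<le> k" for k
    using that
  proof (induction k rule: dec_induct)
    case (step k)
    then show ?case
      using \<Phi>_step[of k] by (simp add: algebra_simps)
  qed simp
  define C where "C = \<bar>\<Phi> K - \<tau> * real K - 3 * \<tau> * (ln (3 * \<tau>) - 1)\<bar>"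
  \<comment> \<open>Since \<open>U k \<le> s k\<close>, the logarithms in \<open>\<Phi> k\<close>
    add at most \<open>3 * \<tau> * ln (u k)\<close> to \<open>u k\<close>. The tangent of
    \<open>ln\<close> at \<open>3 * \<tau>\<close> bounds this by one more \<open>u k\<close> and a
    constant, hence the factor 2.\<close>
  have growth: "\<tau> * real k - C \<le> 2 * u k" if "K \<le> k" for k
  proof -
    have "ln (s k) / 2 + ln (U k) \<ge> - 3 * ln (u k)"
      using ln_ratio(2)[OF that] by (simp add: u(2))
    then have "\<tau> * (- 3 * ln (u k)) \<le> \<tau> * (ln (s k) / 2 + ln (U k))"
      using \<tau> by (intro mult_left_mono) auto
    moreover have "ln (u k) - ln (3 * \<tau>) \<le> u k / (3 * \<tau>) - 1"
      using ln_le_minus_one[of "u k / (3 * \<tau>)"] u(1)[of k] \<tau> by (simp add: ln_div)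
    then have "3 * \<tau> * (ln (u k) - ln (3 * \<tau>)) \<le> 3 * \<tau> * (u k / (3 * \<tau>) - 1)"
      using \<tau> by (intro mult_left_mono) auto
    then have "3 * \<tau> * ln (u k) \<le> u k + 3 * \<tau> * (ln (3 * \<tau>) - 1)"
      using \<tau> by (simp add: algebra_simps)
    ultimately show ?thesis
      using \<Phi>_ge[OF that] unfolding \<Phi>_def C_def by (simp add: algebra_simps)
  qed
  show ?thesis
    unfolding eventually_sequentially
  proof (intro exI allI impI)
    fix k
    \<comment> \<open>From this index on \<open>C\<close> takes at most half of
      \<open>\<tau> * real k\<close>, which turns the factor 2 into 4.\<close>
    assume k: "max K (nat \<lceil>2 * C / \<tau>\<rceil>) \<le> k"
    then have "2 * C / \<tau> \<le> real k"
      by linarith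
    then have "C \<le> \<tau> * real k / 2"
      using \<tau> by (simp add: field_simps)
    then show "\<tau> * real k \<le> 4 / sqrt (U k)"
      using growth[of k] k by (simp add: u_def)
  qed
qed

lemma little_o_inverse_square:
  fixes s U :: "nat \<Rightarrow> real"
  assumes "\<And>k. 0 < s k" and U: "\<And>k. 0 < U k" and "0 < c"
    and "\<And>k. U (Suc k) \<le> U k - c * (s (Suc k))\<^sup>2 / sqrt (s k)"
    and "(\<lambda>k. U k / s k) \<longlonglongrightarrow> 0"
  shows "(\<lambda>k. (real k)\<^sup>2 * U k) \<longlonglongrightarrow> 0"
proof (rule tendstoI)
  fix e :: real
  assume "0 < e"
  \<comment> \<open>Taking 5 rather than 4 in \<open>\<tau>\<close> makes the final bound
    \<open>16/25 * e\<close>, strictly below \<open>e\<close>.\<close>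
  have "\<forall>\<^sub>F k in sequentially. 5 / sqrt e * real k \<le> 4 / sqrt (U k)"
    using \<open>0 < e\<close> by (intro inverse_sqrt_growth[OF assms(1-3) _ assms(4,5)]) auto
  then show "\<forall>\<^sub>F k in sequentially. dist ((real k)\<^sup>2 * U k) 0 < e"
  proof eventually_elim
    case (elim k)
    then have "5 * (real k * sqrt (U k)) \<le> 4 * sqrt e"
      using U[of k] \<open>0 < e\<close> by (simp add: field_simps)
    then have "(5 * (real k * sqrt (U k)))\<^sup>2 \<le> (4 * sqrt e)\<^sup>2"
      using U[of k] by (intro power_mono) (auto simp: less_imp_le)
    then have "25 * ((real k)\<^sup>2 * U k) \<le> 16 * e"
      using U[of k] \<open>0 < e\<close> by (simp add: power_mult_distrib)
    then show ?case
      using U[of k] \<open>0 < e\<close> by (simp add: dist_real_def abs_of_nonneg less_imp_le)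
  qed
qed

text \<open>\<open>U\<close> decreases and is bounded below, so its decrements vanish; as
  \<open>s k \<le> S\<close>, they dominate a fixed multiple of
  \<open>(s (Suc k))\<^sup>2\<close>.\<close>

lemma tendsto_zero_if_square_le_decrease:
  fixes s U :: "nat \<Rightarrow> real"
  assumes s: "\<And>k. 0 < s k" "\<And>k. s k \<le> S" and U: "\<And>k. 0 \<le> U k" and c: "0 < c"
    and step: "\<And>k. U (Suc k) \<le> U k - c * (s (Suc k))\<^sup>2 / sqrt (s k)"
  shows "s \<longlonglongrightarrow> 0"
proof -
  have "U (Suc k) \<le> U k" for k
  proof -
    have "0 \<le> c * (s (Suc k))\<^sup>2 / sqrt (s k)"
      using c s(1)[of k] by simp
    then show ?thesis
      using step[of k] by linarith
  qed
  then have "convergent U"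
    using U by (intro Bseq_monoseq_convergent decseq_imp_monoseq decseq_SucI)
      (auto simp: decseq_SucI intro!: decseq_bounded)
  then obtain L where L: "U \<longlonglongrightarrow> L"
    by (auto simp: convergent_def)
  have lim: "(\<lambda>k. sqrt S / c * (U k - U (Suc k))) \<longlonglongrightarrow> sqrt S / c * (L - L)"
    using L by (intro tendsto_intros LIMSEQ_Suc)
  have "(s (Suc k))\<^sup>2 \<le> sqrt S / c * (U k - U (Suc k))" for k
  proof -
    have "c * (s (Suc k))\<^sup>2 \<le> sqrt (s k) * (U k - U (Suc k))"
      using step[of k] s(1)[of k] by (simp add: field_simps)
    also have "\<dots> \<le> sqrt S * (U k - U (Suc k))"
      using s(2)[of k] \<open>U (Suc k) \<le> U k\<close> by (intro mult_right_mono) auto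
    finally show ?thesis
      using c by (simp add: field_simps)
  qed
  then have le: "\<forall>\<^sub>F k in sequentially. (s (Suc k))\<^sup>2 \<le> sqrt S / c * (U k - U (Suc k))"
    by (rule always_eventually[OF allI])
  have "(\<lambda>k. (s (Suc k))\<^sup>2) \<longlonglongrightarrow> 0"
    by (rule tendsto_sandwich[OF _ le tendsto_const]) (use lim in simp_all)
  then have "(\<lambda>k. sqrt ((s (Suc k))\<^sup>2)) \<longlonglongrightarrow> sqrt 0"
    by (rule tendsto_real_sqrt)
  then have "(\<lambda>k. s (Suc k)) \<longlonglongrightarrow> 0"
    using s(1) by (simp add: less_imp_le)
  then show ?thesis
    by (rule LIMSEQ_imp_Suc)
qed

section \<open>The merit function along the iteration\<close>

text \<open>Replaces the extended-real supremum by a real least upper bound; the choice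
  \<open>z = x\<close> shows that it is nonnegative.\<close>

lemma merit_finite:
  assumes "\<And>z. Min (range (\<lambda>i. f i x - f i z)) \<le> B"
  shows "merit f x = ereal (real_of_ereal (merit f x))" (is ?finite)
    and "0 \<le> real_of_ereal (merit f x)" (is ?nonneg)
    and "Min (range (\<lambda>i. f i x - f i z)) \<le> real_of_ereal (merit f x)" (is ?upper)
    and "(\<And>z. Min (range (\<lambda>i. f i x - f i z)) \<le> C) \<Longrightarrow> real_of_ereal (merit f x) \<le> C"
proof -
  have lower: "ereal (Min (range (\<lambda>i. f i x - f i z))) \<le> merit f x" for z
    unfolding merit_def by (rule SUP_upper) simp
  have upper: "merit f x \<le> ereal C" if "\<And>z. Min (range (\<lambda>i. f i x - f i z)) \<le> C" for C
    unfolding merit_def using that by (intro SUP_least) simp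
  have "0 \<le> merit f x"
    using lower[of x] by (simp add: zero_ereal_def)
  then obtain U where U: "merit f x = ereal U" "0 \<le> U"
    using upper[OF assms] by (cases "merit f x") auto
  then show ?finite ?nonneg
    by simp_all
  show ?upper
    using lower[of z] by (simp add: U)
  show "real_of_ereal (merit f x) \<le> C" if "\<And>z. Min (range (\<lambda>i. f i x - f i z)) \<le> C"
    using upper[OF that] by (simp add: U)
qed

text \<open>Only points \<open>z\<close> of the level set matter in the supremum.\<close>

lemma Min_le_if_bounded_level_set:
  fixes f :: "'m::finite \<Rightarrow> real^'n \<Rightarrow> real"
  assumes "\<And>i. twice_continuously_differentiable (f i)" "\<And>i. convex_on UNIV (f i)"
    and bounded: "bounded {y. \<forall>i. f i y \<le> f i x0}" and x: "\<And>i. f i x \<le> f i x0"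
  shows "Min (range (\<lambda>i. f i x - f i z)) \<le> stationarity f x * diameter {y. \<forall>i. f i y \<le> f i x0}"
proof (cases "\<forall>i. f i z \<le> f i x")
  case True
  obtain l where l: "l \<in> unit_simplex"
    "stationarity f x = norm (\<Sum>i\<in>UNIV. l $ i *\<^sub>R grad (f i) x)"
    by (rule stationarity_attained)
  have "Min (range (\<lambda>i. f i x - f i z)) \<le> (\<Sum>i\<in>UNIV. l $ i * (f i x - f i z))"
    by (rule unit_simplex_average_ge[OF l(1)]) simp
  also have "\<dots> \<le> (\<Sum>i\<in>UNIV. l $ i *\<^sub>R grad (f i) x) \<bullet> (x - z)"
    by (rule weighted_gradient_inequality[OF assms(1,2) l(1)])
  also have "\<dots> \<le> stationarity f x * norm (x - z)"
    unfolding l(2) by (rule norm_cauchy_schwarz)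
  also have "\<dots> \<le> stationarity f x * diameter {y. \<forall>i. f i y \<le> f i x0}"
    using diameter_bounded_bound[OF bounded, of x z] True x order_trans
    by (intro mult_left_mono stationarity_nonneg) (fastforce simp: dist_norm)
  finally show ?thesis .
next
  case False
  then obtain i where "f i x - f i z < 0"
    by (auto simp: not_le)
  then have "Min (range (\<lambda>i. f i x - f i z)) < 0"
    by (subst Min_less_iff) auto
  also have "0 \<le> stationarity f x * diameter {y. \<forall>i. f i y \<le> f i x0}"
    by (intro mult_nonneg_nonneg stationarity_nonneg diameter_ge_0[OF bounded])
  finally show ?thesis
    by simp
qed

text \<open>Along a subsequence let the iterates converge to \<open>p\<close> and the optimal weights \<open>\<mu> k\<close> of
  the stationarity measure to \<open>l\<close>. The \<open>l\<close>-weighted sum of the objectives is minimal at \<open>p\<close>,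
  so it bounds the merit function by \<open>\<Sum>i. l i * (f i (x k) - f i p)\<close>. The terms are nonnegative
  and \<open>l i \<le> 2 * \<mu> k i\<close> eventually, so passing to the weights \<open>\<mu> k\<close> costs a factor 2
  and gives \<open>2 * stationarity * dist (x k) p\<close>.\<close>

lemma merit_over_stationarity_tendsto_zero:
  fixes f :: "'m::finite \<Rightarrow> real^'n \<Rightarrow> real"
  assumes f: "\<And>i. twice_continuously_differentiable (f i)" "\<And>i. convex_on UNIV (f i)"
    and S: "compact S" "\<And>k. x k \<in> S"
    and decreasing: "\<And>i. decseq (\<lambda>k. f i (x k))"
    and pos: "\<And>k. 0 < stationarity f (x k)"
    and stat: "(\<lambda>k. stationarity f (x k)) \<longlonglongrightarrow> 0"
    and U: "\<And>k. 0 \<le> U k"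
      "\<And>k C. (\<And>z. Min (range (\<lambda>i. f i (x k) - f i z)) \<le> C) \<Longrightarrow> U k \<le> C"
  shows "(\<lambda>k. U k / stationarity f (x k)) \<longlonglongrightarrow> 0"
proof (rule ccontr)
  assume "\<not> (\<lambda>k. U k / stationarity f (x k)) \<longlonglongrightarrow> 0"
  then obtain e where "0 < e" and
    e: "\<not> (\<forall>\<^sub>F k in sequentially. dist (U k / stationarity f (x k)) 0 < e)"
    by (auto simp: tendsto_iff)
  define N where "N = {k. e * stationarity f (x k) \<le> U k}"
  have "\<not> (\<forall>\<^sub>F k in sequentially. k \<notin> N)"
    using e pos U(1) by (simp add: N_def not_le pos_divide_less_eq abs_of_nonneg less_imp_le)
  then have "infinite N"
    using eventually_sequentially finite_nat_set_iff_bounded by (metis linorder_not_le)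
  then obtain r0 :: "nat \<Rightarrow> nat" where r0: "strict_mono r0" "\<And>n. r0 n \<in> N"
    using infinite_enumerate by blast
  have "\<exists>l. l \<in> unit_simplex \<and> stationarity f (x k) = norm (\<Sum>i\<in>UNIV. l $ i *\<^sub>R grad (f i) (x k))" for k
    using stationarity_attained by metis
  then obtain \<mu> where \<mu>: "\<And>k. \<mu> k \<in> unit_simplex"
    "\<And>k. stationarity f (x k) = norm (\<Sum>i\<in>UNIV. \<mu> k $ i *\<^sub>R grad (f i) (x k))"
    by metis
  \<comment> \<open>Compactness of the product yields one subsequence along which iterates and
    weights converge together.\<close>
  have "seq_compact (S \<times> (unit_simplex :: (real^'m) set))"
    using compact_Times[OF S(1) compact_unit_simplex] by (simp add: compact_eq_seq_compact_metric)
  then obtain q r1 where q: "q \<in> S \<times> unit_simplex" and r1: "strict_mono r1"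
    "((\<lambda>n. (x (r0 n), \<mu> (r0 n))) \<circ> r1) \<longlonglongrightarrow> q"
    using S(2) \<mu>(1) by (elim seq_compactE[of _ "\<lambda>n. (x (r0 n), \<mu> (r0 n))"]) auto
  define p l where "p = fst q" and "l = snd q"
  define r where "r n = r0 (r1 n)" for n
  have r: "strict_mono r" "\<And>n. r n \<in> N"
    using r0 r1(1) by (simp_all add: r_def strict_mono_def)
  have l: "l \<in> unit_simplex"
    using q by (auto simp: l_def)
  have x_lim: "(\<lambda>n. x (r n)) \<longlonglongrightarrow> p" and \<mu>_lim: "(\<lambda>n. \<mu> (r n)) \<longlonglongrightarrow> l"
    using tendsto_fst[OF r1(2)] tendsto_snd[OF r1(2)] by (simp_all add: p_def l_def r_def o_def)
  have grad_lim: "(\<lambda>n. grad (f i) (x (r n))) \<longlonglongrightarrow> grad (f i) p" for i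
    using continuous_on_tendsto_compose[OF continuous_on_grad[OF f(1)[of i], of UNIV] x_lim] by simp
  have f_lim: "(\<lambda>n. f i (x (r n))) \<longlonglongrightarrow> f i p" for i
    using continuous_on_tendsto_compose[OF
        continuous_on_twice_continuously_differentiable[OF f(1)[of i], of UNIV] x_lim] by simp
  \<comment> \<open>Each objective decreases along the run, so it stays above its subsequential
    limit; this makes the weighted terms nonnegative.\<close>
  have above: "f i p \<le> f i (x (r n))" for i n
  proof (rule decseq_ge[OF _ f_lim])
    show "decseq (\<lambda>n. f i (x (r n)))"
      using decreasing[of i] strict_mono_less_eq[OF r(1)] by (simp add: decseq_def)
  qed
  have "(\<lambda>n. stationarity f (x (r n))) \<longlonglongrightarrow> norm (\<Sum>i\<in>UNIV. l $ i *\<^sub>R grad (f i) p)"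
    unfolding \<mu>(2) by (intro tendsto_intros \<mu>_lim grad_lim)
  moreover have "(\<lambda>n. stationarity f (x (r n))) \<longlonglongrightarrow> 0"
    using LIMSEQ_subseq_LIMSEQ[OF stat r(1)] by (simp add: o_def)
  ultimately have stationary: "(\<Sum>i\<in>UNIV. l $ i *\<^sub>R grad (f i) p) = 0"
    using LIMSEQ_unique by fastforce
  have U_le: "U k \<le> (\<Sum>i\<in>UNIV. l $ i * (f i (x k) - f i p))" for k
  proof (rule U(2))
    fix z
    have "Min (range (\<lambda>i. f i (x k) - f i z)) \<le> (\<Sum>i\<in>UNIV. l $ i * (f i (x k) - f i z))"
      by (rule unit_simplex_average_ge[OF l]) simp
    also have "\<dots> = (\<Sum>i\<in>UNIV. l $ i * (f i (x k) - f i p)) + (\<Sum>i\<in>UNIV. l $ i * (f i p - f i z))"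
      by (simp add: algebra_simps flip: sum.distrib)
    also have "(\<Sum>i\<in>UNIV. l $ i * (f i p - f i z)) \<le> 0"
      using weighted_gradient_inequality[of f l p z, OF f l] stationary by simp
    finally show "Min (range (\<lambda>i. f i (x k) - f i z)) \<le> (\<Sum>i\<in>UNIV. l $ i * (f i (x k) - f i p))"
      by simp
  qed
  have "\<forall>\<^sub>F n in sequentially. l $ i \<le> 2 * \<mu> (r n) $ i" for i
  proof (cases "l $ i = 0")
    case True
    then show ?thesis
      using unit_simplex_nonneg[OF \<mu>(1)] by simp
  next
    case False
    then have "l $ i / 2 < l $ i"
      using unit_simplex_nonneg[OF l, of i] by simp
    then have "\<forall>\<^sub>F n in sequentially. l $ i / 2 < \<mu> (r n) $ i"
      using tendsto_vec_nth[OF \<mu>_lim] by (rule order_tendstoD(1)[rotated])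
    then show ?thesis
      by eventually_elim simp
  qed
  then have "\<forall>\<^sub>F n in sequentially. \<forall>i. l $ i \<le> 2 * \<mu> (r n) $ i"
    by (rule eventually_all_finite)
  \<comment> \<open>The radius \<open>e / 2\<close> offsets the factor 2 from the weights: the bound
    falls strictly below \<open>e * stationarity f (x (r n))\<close>, against membership in
    \<open>N\<close>.\<close>
  moreover have "\<forall>\<^sub>F n in sequentially. dist (x (r n)) p < e / 2"
    using \<open>0 < e\<close> by (intro tendstoD[OF x_lim]) simp
  ultimately have "\<forall>\<^sub>F n in sequentially. False"
  proof eventually_elim
    case (elim n)
    let ?x = "x (r n)"
    have "U (r n) \<le> (\<Sum>i\<in>UNIV. l $ i * (f i ?x - f i p))"
      by (rule U_le)
    also have "\<dots> \<le> (\<Sum>i\<in>UNIV. 2 * \<mu> (r n) $ i * (f i ?x - f i p))"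
      using elim(1) above by (intro sum_mono mult_right_mono) auto
    also have "\<dots> = 2 * (\<Sum>i\<in>UNIV. \<mu> (r n) $ i * (f i ?x - f i p))"
      by (simp add: sum_distrib_left mult.assoc)
    also have "\<dots> \<le> 2 * ((\<Sum>i\<in>UNIV. \<mu> (r n) $ i *\<^sub>R grad (f i) ?x) \<bullet> (?x - p))"
      using weighted_gradient_inequality[of f "\<mu> (r n)" ?x p, OF f \<mu>(1)] by simp
    also have "\<dots> \<le> 2 * (stationarity f ?x * dist ?x p)"
      unfolding \<mu>(2) dist_norm using norm_cauchy_schwarz by (intro mult_left_mono) auto
    also have "\<dots> < 2 * (stationarity f ?x * (e / 2))"
      using elim(2) pos[of "r n"] by simp
    also have "\<dots> \<le> U (r n)"
      using r(2)[of n] by (simp add: N_def mult.commute)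
    finally show ?case
      by simp
  qed
  then show False
    by simp
qed

lemma stationarity_bounded:
  fixes f :: "'m::finite \<Rightarrow> real^'n \<Rightarrow> real"
  assumes "\<And>i. twice_continuously_differentiable (f i)" and "compact S"
  obtains B where "\<And>x. x \<in> S \<Longrightarrow> stationarity f x \<le> B"
proof -
  obtain i :: 'm where True by simp
  have "bounded (grad (f i) ` S)"
    by (intro compact_imp_bounded compact_continuous_image continuous_on_grad assms)
  then obtain B where B: "\<And>x. x \<in> S \<Longrightarrow> norm (grad (f i) x) \<le> B"
    by (auto simp: bounded_iff)
  \<comment> \<open>A vertex of the simplex is an admissible weight vector, so one gradient already
    bounds the measure.\<close>
  have "stationarity f x \<le> norm (grad (f i) x)" for x
    using stationarity_le[OF axis_in_unit_simplex, of f x i]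
    by (simp add: axis_def if_distrib[of "\<lambda>c. c *\<^sub>R _"] cong: if_cong)
  then show thesis
    using B by (intro that[of B]) (meson order_trans)
qed

lemma hessian_lipschitz_mono:
  assumes "hessian_lipschitz L g" "L \<le> L'"
  shows "hessian_lipschitz L' g"
  using assms unfolding hessian_lipschitz_def by (meson mult_right_mono norm_ge_zero order_trans)

theorem theorem3p8:
  fixes f :: "'m::finite \<Rightarrow> real^'n \<Rightarrow> real"
    and Hc :: "'m \<Rightarrow> real"
    and H :: real
    and x0 :: "real^'n"
    and x :: "nat \<Rightarrow> real^'n"
  assumes "\<And>i. convex_on UNIV (f i)"
    and "\<And>i. twice_continuously_differentiable (f i)"
    and "\<And>i. 0 < Hc i"
    and "\<And>i. hessian_lipschitz (Hc i) (f i)"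
    and "H = Max (range Hc)"
    and "compact {y. \<forall>i. f i y \<le> f i x0}"
    and "newton_run f H x0 x"
  shows "((\<nexists>N. terminates_at f x N) \<longrightarrow>
            (\<lambda>k. ereal ((real k)\<^sup>2) * merit f (x k)) \<longlonglongrightarrow> 0) \<and>
         (\<forall>N. terminates_at f x N \<longrightarrow> weakly_Pareto_optimal f (x N))"
proof (intro conjI impI allI)
  fix N
  assume "terminates_at f x N"
  then show "weakly_Pareto_optimal f (x N)"
    by (intro stationary_imp_weakly_Pareto_optimal assms) (simp add: terminates_at_def)
next
  assume "\<nexists>N. terminates_at f x N"
  \<comment> \<open>If the measure vanished anywhere, the least such index would be a termination
    index.\<close>
  then have nonzero: "stationarity f (x k) \<noteq> 0" for k
    unfolding terminates_at_def
    using exists_least_iff[of "\<lambda>N. stationarity f (x N) = 0"] by blast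
  then have pos: "0 < stationarity f (x k)" for k
    using stationarity_nonneg[of f "x k"] by (simp add: less_le)
  have "Hc i \<le> H" for i
    by (simp add: assms(5))
  then have H: "0 < H" "\<And>i. hessian_lipschitz H (f i)"
    using assms(3,4) hessian_lipschitz_mono less_le_trans by blast+
  define c where "c = 1 / (5 * sqrt H)"
  have "0 < c"
    using H(1) by (simp add: c_def)
  define \<Delta> where "\<Delta> k = c * (stationarity f (x (Suc k)))\<^sup>2 / sqrt (stationarity f (x k))" for k
  have \<Delta>: "0 < \<Delta> k" for k
    using pos[of k] pos[of "Suc k"] \<open>0 < c\<close> by (simp add: \<Delta>_def)
  have step: "f i (x (Suc k)) \<le> f i (x k) - \<Delta> k" for i k
  proof -
    obtain d where "is_arg_min (newton_objective f H (x k)) (\<lambda>_. True) d" "x (Suc k) = x k + d"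
      using assms(7) nonzero unfolding newton_run_def by blast
    with newton_step_decrease[of f, OF assms(2) H(2) assms(1) H(1) nonzero, of k d i]
    show ?thesis
      by (simp add: \<Delta>_def c_def real_sqrt_mult mult_ac)
  qed
  have decreasing: "decseq (\<lambda>k. f i (x k))" for i
  proof (rule decseq_SucI)
    show "f i (x (Suc k)) \<le> f i (x k)" for k
      using step[of i k] \<Delta>[of k] by linarith
  qed
  let ?L = "{y. \<forall>i. f i y \<le> f i x0}"
  have "x 0 = x0"
    using assms(7) by (simp add: newton_run_def)
  then have level: "f i (x k) \<le> f i x0" for i k
    using decseqD[OF decreasing, of 0 k i] by simp
  have "bounded ?L"
    using assms(6) by (rule compact_imp_bounded)
  define U where "U k = real_of_ereal (merit f (x k))" for k
  note U = merit_finite[of f "x _", OF Min_le_if_bounded_level_set[of f, OF assms(2,1) \<open>bounded ?L\<close> level],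
      folded U_def]
  have U_step: "U (Suc k) \<le> U k - \<Delta> k" for k
  proof (rule U(4))
    fix z
    \<comment> \<open>All objectives drop by at least the same \<open>\<Delta> k\<close>, so for
      each \<open>z\<close> the minimal gap does too, and this passes to the supremum.\<close>
    have "Min (range (\<lambda>i. f i (x (Suc k)) - f i z)) + \<Delta> k \<le> Min (range (\<lambda>i. f i (x k) - f i z))"
    proof (subst Min_ge_iff)
      have "Min (range (\<lambda>i. f i (x (Suc k)) - f i z)) \<le> f i (x (Suc k)) - f i z" for i
        by simp
      then show "\<forall>a\<in>range (\<lambda>i. f i (x k) - f i z).
          Min (range (\<lambda>i. f i (x (Suc k)) - f i z)) + \<Delta> k \<le> a"
        using step[of _ k] by (smt (verit) imageE)
    qed auto
    then show "Min (range (\<lambda>i. f i (x (Suc k)) - f i z)) \<le> U k - \<Delta> k"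
      using U(3)[of k z] by linarith
  qed
  \<comment> \<open>Strict positivity, needed for \<open>1 / sqrt (U k)\<close>, follows because a
    further positive decrease still leaves a nonnegative value.\<close>
  have U_pos: "0 < U k" for k
    using U_step[of k] U(2)[of "Suc k"] \<Delta>[of k] by linarith
  obtain B where B: "\<And>y. y \<in> ?L \<Longrightarrow> stationarity f y \<le> B"
    using stationarity_bounded[of f, OF assms(2,6)] by blast
  have "(\<lambda>k. stationarity f (x k)) \<longlonglongrightarrow> 0"
    using U_step level unfolding \<Delta>_def
    by (intro tendsto_zero_if_square_le_decrease[where U=U and c=c and S=B] pos U(2) \<open>0 < c\<close> B) auto
  then have "(\<lambda>k. U k / stationarity f (x k)) \<longlonglongrightarrow> 0"
    using level by (intro merit_over_stationarity_tendsto_zero[OF assms(2,1,6)] decreasing pos U(2,4)) auto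
  then have "(\<lambda>k. (real k)\<^sup>2 * U k) \<longlonglongrightarrow> 0"
    using U_step unfolding \<Delta>_def by (intro little_o_inverse_square[OF pos U_pos \<open>0 < c\<close>])
  then show "(\<lambda>k. ereal ((real k)\<^sup>2) * merit f (x k)) \<longlonglongrightarrow> 0"
    by (simp add: U(1) zero_ereal_def)
qed

end
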